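(* (Abel's formula.) If $x,y$ are solutions of $Lx=0$ on $\mathcal I$, then for fixed $b\in\mathcal I$ $$W(x,y)(t)=\frac{c\,e_0^2(t,b)}{p(t)},\qquad t\in\mathcal I,$$ where $c=p(b)W(x,y)(b)$ is a constant.
   Context: $\mathcal I\subseteq\mathbb R$ is a nondegenerate interval. The functions $\kappa_0,\kappa_1:[0,1]\times\mathcal I\to[0,\infty)$ are continuous and satisfy, for all $t\in\mathcal I$: $\lim_{\alpha\to0^+}\kappa_1(\alpha,t)=1$, $\lim_{\alpha\to0^+}\kappa_0(\alpha,t)=0$, $\lim_{\alpha\to1^-}\kappa_1(\alpha,t)=0$, $\lim_{\alpha\to1^-}\kappa_0(\alpha,t)=1$, $\kappa_1(\alpha,t)\ne0$ for $\alpha\in[0,1)$, and $\kappa_0(\alpha,t)\neq0$ for $\alpha\in(0,1]$. Fix $\alpha\in(0,1]$ and write $\kappa_j(t)=\kappa_j(\alpha,t)$. The conformable (proportional) derivative is $D^{\alpha}f(t)=\kappa_1(t)f(t)+\kappa_0(t)f'(t)$. For $t,s\in\mathcal I$, $e_0(t,s)=\exp\left(-\int_s^t\frac{\kappa_1(\tau)}{\kappa_0(\tau)}\,d\tau\right)$; $e_0^2(t,s)=(e_0(t,s))^2$. Let $p,q$ be continuous on $\mathcal I$ with $p(t)>0$ for all $t\in\mathcal I$, and set $Lx=D^{\alpha}[pD^{\alpha}x]+qx$. $\mathbb D$ is the set of all continuous functions $x$ on $\mathcal I$ such that $D^{\alpha}x$ and $D^{\alpha}[pD^{\alpha}x]$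 exist and are continuous on $\mathcal I$; a solution of $Lx=0$ on $\mathcal I$ is an $x\in\mathbb D$ with $Lx(t)=0$ for all $t\in\mathcal I$. The conformable Wronskian is $W(x,y)=xD^{\alpha}y-yD^{\alpha}x$. *)

theory Defs
  imports "HOL-Analysis.Analysis"
begin

definition nondegenerate_interval :: "real set \<Rightarrow> bool" where
  "nondegenerate_interval I \<longleftrightarrow> is_interval I \<and> (\<exists>a\<in>I. \<exists>b\<in>I. a < b)"

text \<open>The kernels are curried: \<open>\<kappa> \<alpha> t\<close>, with the order parameter \<open>\<alpha>\<close> first. Functions on
  an interval \<open>I\<close> are total functions on the reals of which only the values on \<open>I\<close> matter.\<close>

definition conformable_kernels ::
  "real set \<Rightarrow> (real \<Rightarrow> real \<Rightarrow> real) \<Rightarrow> (real \<Rightarrow> real \<Rightarrow> real) \<Rightarrow> bool" where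
  "conformable_kernels I \<kappa>0 \<kappa>1 \<longleftrightarrow>
     continuous_on ({0..1} \<times> I) (\<lambda>(\<alpha>, t). \<kappa>0 \<alpha> t) \<and>
     continuous_on ({0..1} \<times> I) (\<lambda>(\<alpha>, t). \<kappa>1 \<alpha> t) \<and>
     (\<forall>\<alpha>\<in>{0..1}. \<forall>t\<in>I. 0 \<le> \<kappa>0 \<alpha> t \<and> 0 \<le> \<kappa>1 \<alpha> t) \<and>
     (\<forall>t\<in>I.
        ((\<lambda>\<alpha>. \<kappa>1 \<alpha> t) \<longlongrightarrow> 1) (at_right 0) \<and>
        ((\<lambda>\<alpha>. \<kappa>0 \<alpha> t) \<longlongrightarrow> 0) (at_right 0) \<and>
        ((\<lambda>\<alpha>. \<kappa>1 \<alpha> t) \<longlongrightarrow> 0) (at_left 1) \<and>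
        ((\<lambda>\<alpha>. \<kappa>0 \<alpha> t) \<longlongrightarrow> 1) (at_left 1) \<and>
        (\<forall>\<alpha>\<in>{0..<1}. \<kappa>1 \<alpha> t \<noteq> 0) \<and>
        (\<forall>\<alpha>\<in>{0<..1}. \<kappa>0 \<alpha> t \<noteq> 0))"

text \<open>From here on \<open>k0\<close> and \<open>k1\<close> are the kernels at a fixed order, \<open>k0 = \<kappa>0 \<alpha>\<close> and
  \<open>k1 = \<kappa>1 \<alpha>\<close>. Derivatives are taken within \<open>I\<close>, so they are one-sided at an endpoint
  belonging to \<open>I\<close>.\<close>

definition conf_deriv ::
  "real set \<Rightarrow> (real \<Rightarrow> real) \<Rightarrow> (real \<Rightarrow> real) \<Rightarrow> (real \<Rightarrow> real) \<Rightarrow> real \<Rightarrow> real" where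
  "conf_deriv I k0 k1 f t = k1 t * f t + k0 t * vector_derivative f (at t within I)"

text \<open>\<open>f differentiable_on I\<close> says that the conformable derivative of \<open>f\<close> exists on \<open>I\<close>; otherwise
  \<^const>\<open>vector_derivative\<close> has an unspecified value.\<close>

definition has_cont_conf_deriv ::
  "real set \<Rightarrow> (real \<Rightarrow> real) \<Rightarrow> (real \<Rightarrow> real) \<Rightarrow> (real \<Rightarrow> real) \<Rightarrow> bool" where
  "has_cont_conf_deriv I k0 k1 f \<longleftrightarrow>
     f differentiable_on I \<and> continuous_on I (conf_deriv I k0 k1 f)"

text \<open>The integral is oriented: exchanging the bounds changes the sign.\<close>

definition conf_exp0 ::
  "(real \<Rightarrow> real) \<Rightarrow> (real \<Rightarrow> real) \<Rightarrow> real \<Rightarrow> real \<Rightarrow> real" where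
  "conf_exp0 k0 k1 t s = exp (- (LBINT \<tau>=s..t. k1 \<tau> / k0 \<tau>))"

definition conf_L ::
  "real set \<Rightarrow> (real \<Rightarrow> real) \<Rightarrow> (real \<Rightarrow> real) \<Rightarrow> (real \<Rightarrow> real) \<Rightarrow> (real \<Rightarrow> real) \<Rightarrow>
     (real \<Rightarrow> real) \<Rightarrow> real \<Rightarrow> real" where
  "conf_L I k0 k1 p q x t =
     conf_deriv I k0 k1 (\<lambda>s. p s * conf_deriv I k0 k1 x s) t + q t * x t"

definition conf_domain ::
  "real set \<Rightarrow> (real \<Rightarrow> real) \<Rightarrow> (real \<Rightarrow> real) \<Rightarrow> (real \<Rightarrow> real) \<Rightarrow> (real \<Rightarrow> real) set" where
  "conf_domain I k0 k1 p =
     {x. continuous_on I x \<and>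
         has_cont_conf_deriv I k0 k1 x \<and>
         has_cont_conf_deriv I k0 k1 (\<lambda>s. p s * conf_deriv I k0 k1 x s)}"

definition conf_solution ::
  "real set \<Rightarrow> (real \<Rightarrow> real) \<Rightarrow> (real \<Rightarrow> real) \<Rightarrow> (real \<Rightarrow> real) \<Rightarrow> (real \<Rightarrow> real) \<Rightarrow>
     (real \<Rightarrow> real) \<Rightarrow> bool" where
  "conf_solution I k0 k1 p q x \<longleftrightarrow>
     x \<in> conf_domain I k0 k1 p \<and> (\<forall>t\<in>I. conf_L I k0 k1 p q x t = 0)"

definition conf_wronskian ::
  "real set \<Rightarrow> (real \<Rightarrow> real) \<Rightarrow> (real \<Rightarrow> real) \<Rightarrow> (real \<Rightarrow> real) \<Rightarrow> (real \<Rightarrow> real) \<Rightarrow>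
     real \<Rightarrow> real" where
  "conf_wronskian I k0 k1 x y t =
     x t * conf_deriv I k0 k1 y t - y t * conf_deriv I k0 k1 x t"

end

theory Submission
  imports Defs
begin

text \<open>With $u = p D^\alpha x$, $v = p D^\alpha y$ and $w = p\,W(x,y) = x v - y u$, the equations
  $x' = (u/p - \kappa_1 x)/\kappa_0$ and $u' = (-q x - \kappa_1 u)/\kappa_0$ (and likewise for $y, v$)
  give $w' = -2(\kappa_1/\kappa_0) w$: the $q$- and $uv$-terms cancel. Hence
  $w(t) \exp(2\int_b^t \kappa_1/\kappa_0)$ is constant. The function $p$ need not be
  differentiable, so the product $w$ is differentiated through $u$ and $v$.\<close>

text \<open>Integrating factor: \<open>w\<close> times \<open>exp (- m * G)\<close>, with
  \<open>G\<close> the integral of \<open>g\<close> from \<open>b\<close>, has derivative zero. The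
  factor \<open>m\<close> is kept separate from \<open>g\<close> so that it ends up in front of the
  integral, ready to be read as a square of an exponential.\<close>

lemma linear_ode_solution:
  fixes w g :: "real \<Rightarrow> real"
  assumes I: "is_interval I" and b: "b \<in> I" and t: "t \<in> I"
    and g: "continuous_on I g"
    and w: "\<And>s. s \<in> I \<Longrightarrow> (w has_vector_derivative m * g s * w s) (at s within I)"
  shows "w t = w b * exp (m * (LBINT \<tau>=b..t. g \<tau>))"
proof -
  \<comment> \<open>\<open>I\<close> may be open or unbounded, so the argument runs on the compact
    interval spanned by \<open>b\<close> and \<open>t\<close>, in either order.\<close>
  define J where "J = {min b t..max b t}"
  have JI: "J \<subseteq> I"
  proof
    fix s assume "s \<in> J"
    then show "s \<in> I"
      using mem_is_interval_1_I[OF I b t, of s] mem_is_interval_1_I[OF I t b, of s]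
      unfolding J_def by (cases "b \<le> t") simp_all
  qed
  define G where "G s = (LBINT \<tau>=b..s. g \<tau>)" for s :: real
  have G: "(G has_real_derivative g s) (at s within J)" if "s \<in> J" for s
    \<comment> \<open>The base point \<open>b\<close> may be either end of \<open>J\<close>; the
      oriented integral covers both cases.\<close>
    using interval_integral_FTC2[of "min b t" b "max b t" g s] that
      continuous_on_subset[OF g JI]
    unfolding J_def G_def by (simp add: has_real_derivative_iff_has_vector_derivative)
  have wJ: "(w has_real_derivative m * g s * w s) (at s within J)" if "s \<in> J" for s
    using has_vector_derivative_within_subset[OF w JI] that JI
    by (auto simp: has_real_derivative_iff_has_vector_derivative)
  have "\<exists>c. \<forall>s\<in>J. w s * exp (- (m * G s)) = c"
  proof (rule has_field_derivative_zero_constant)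
    show "convex J" unfolding J_def by simp
    show "((\<lambda>s. w s * exp (- (m * G s))) has_real_derivative 0) (at s within J)"
      if "s \<in> J" for s
      by (rule DERIV_cong[OF DERIV_mult[OF wJ[OF that]
              DERIV_chain2[OF DERIV_exp DERIV_minus[OF DERIV_cmult[OF G[OF that]]]]]])
        (simp add: algebra_simps)
  qed
  moreover have "t \<in> J" "b \<in> J"
    unfolding J_def by auto
  ultimately have "w t * exp (- (m * G t)) = w b * exp (- (m * G b))"
    by metis
  \<comment> \<open>\<open>G b = 0\<close>, so the exponential on the right is 1.\<close>
  then show ?thesis
    unfolding G_def by (simp add: exp_minus field_simps)
qed

text \<open>Differentiability makes \<open>vector_derivative\<close> the genuine derivative, and
  \<open>k0 t \<noteq> 0\<close> lets the defining formula be solved for it.\<close>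

lemma conf_deriv_imp_has_vector_derivative:
  assumes "has_cont_conf_deriv I k0 k1 f" "t \<in> I" "k0 t \<noteq> 0"
  shows "(f has_vector_derivative (conf_deriv I k0 k1 f t - k1 t * f t) / k0 t) (at t within I)"
  using assms
  by (auto simp: has_cont_conf_deriv_def conf_deriv_def differentiable_on_def
      vector_derivative_works)

text \<open>The second-order equation becomes a first-order system for \<open>x\<close> and
  \<open>p\<close> times its conformable derivative; the second line uses \<open>conf_L\<close> =
  0.\<close>

lemma conf_solution_derivs:
  assumes "conf_solution I k0 k1 p q x" "t \<in> I" "k0 t \<noteq> 0"
  shows "(x has_vector_derivative (conf_deriv I k0 k1 x t - k1 t * x t) / k0 t) (at t within I)"
    and "((\<lambda>s. p s * conf_deriv I k0 k1 x s) has_vector_derivative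
           (- q t * x t - k1 t * (p t * conf_deriv I k0 k1 x t)) / k0 t) (at t within I)"
proof -
  let ?u = "\<lambda>s. p s * conf_deriv I k0 k1 x s"
  have "has_cont_conf_deriv I k0 k1 x" "has_cont_conf_deriv I k0 k1 ?u"
    and Lx: "conf_deriv I k0 k1 ?u t = - q t * x t"
    using assms by (auto simp: conf_solution_def conf_domain_def conf_L_def)
  from conf_deriv_imp_has_vector_derivative[OF this(1) assms(2,3)]
    conf_deriv_imp_has_vector_derivative[OF this(2) assms(2,3)]
  show "(x has_vector_derivative (conf_deriv I k0 k1 x t - k1 t * x t) / k0 t) (at t within I)"
    and "(?u has_vector_derivative (- q t * x t - k1 t * ?u t) / k0 t) (at t within I)"
    unfolding Lx by auto
qed

lemma wronskian_has_vector_derivative: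
  assumes x: "conf_solution I k0 k1 p q x" and y: "conf_solution I k0 k1 p q y"
    and t: "t \<in> I" "k0 t \<noteq> 0"
  shows "((\<lambda>s. p s * conf_wronskian I k0 k1 x y s) has_vector_derivative
           - 2 * (k1 t / k0 t) * (p t * conf_wronskian I k0 k1 x y t)) (at t within I)"
proof -
  let ?u = "\<lambda>s. p s * conf_deriv I k0 k1 x s" and ?v = "\<lambda>s. p s * conf_deriv I k0 k1 y s"
  note derivs = conf_solution_derivs[OF x t] conf_solution_derivs[OF y t]
  have "((\<lambda>s. x s * ?v s - y s * ?u s) has_vector_derivative
      - 2 * (k1 t / k0 t) * (p t * conf_wronskian I k0 k1 x y t)) (at t within I)"
    \<comment> \<open>The product rule is applied to \<open>x * ?v\<close> and
      \<open>y * ?u\<close>. The terms without \<open>k1\<close> cancel in the difference, and each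
      product contributes one factor \<open>- k1 t / k0 t\<close>, whence the 2.\<close>
    by (rule has_vector_derivative_eq_rhs[OF has_vector_derivative_diff
          [OF has_vector_derivative_mult[OF derivs(1,4)] has_vector_derivative_mult[OF derivs(3,2)]]])
      (use t in \<open>simp add: conf_wronskian_def field_simps\<close>)
  then show ?thesis
    by (simp add: conf_wronskian_def algebra_simps)
qed

lemma conformable_kernels_continuous:
  assumes "conformable_kernels I \<kappa>0 \<kappa>1" and "\<alpha> \<in> {0..1}"
  shows "continuous_on I (\<kappa>0 \<alpha>)" and "continuous_on I (\<kappa>1 \<alpha>)"
proof -
  have c: "continuous_on ({0..1} \<times> I) (\<lambda>(\<alpha>, t). \<kappa>0 \<alpha> t)"
    "continuous_on ({0..1} \<times> I) (\<lambda>(\<alpha>, t). \<kappa>1 \<alpha> t)"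
    using assms(1) by (auto simp: conformable_kernels_def)
  have pair: "continuous_on I (Pair \<alpha>)" "Pair \<alpha> ` I \<subseteq> {0..1} \<times> I"
    using assms(2) by (auto intro!: continuous_intros)
  show "continuous_on I (\<kappa>0 \<alpha>)" "continuous_on I (\<kappa>1 \<alpha>)"
    using continuous_on_compose2[OF c(1) pair] continuous_on_compose2[OF c(2) pair] by simp_all
qed

theorem corollary3p9:
  fixes I :: "real set" and \<kappa>0 \<kappa>1 :: "real \<Rightarrow> real \<Rightarrow> real"
    and \<alpha> b :: real and p q x y :: "real \<Rightarrow> real"
  assumes "nondegenerate_interval I"
    and "conformable_kernels I \<kappa>0 \<kappa>1"
    and "\<alpha> \<in> {0<..1}"
    and "continuous_on I p" and "continuous_on I q"
    and "\<forall>t\<in>I. p t > 0"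
    and "conf_solution I (\<kappa>0 \<alpha>) (\<kappa>1 \<alpha>) p q x"
    and "conf_solution I (\<kappa>0 \<alpha>) (\<kappa>1 \<alpha>) p q y"
    and "b \<in> I"
  shows "let c = p b * conf_wronskian I (\<kappa>0 \<alpha>) (\<kappa>1 \<alpha>) x y b in
    \<forall>t\<in>I. conf_wronskian I (\<kappa>0 \<alpha>) (\<kappa>1 \<alpha>) x y t
           = c * (conf_exp0 (\<kappa>0 \<alpha>) (\<kappa>1 \<alpha>) t b)\<^sup>2 / p t"
proof -
  let ?W = "conf_wronskian I (\<kappa>0 \<alpha>) (\<kappa>1 \<alpha>) x y"
  have I: "is_interval I"
    using assms(1) by (simp add: nondegenerate_interval_def)
  have nz: "\<kappa>0 \<alpha> t \<noteq> 0" if "t \<in> I" for t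
    using assms(2,3) that by (auto simp: conformable_kernels_def)
  \<comment> \<open>The quotient is the coefficient \<open>g\<close> of the linear equation;
    \<alpha> > 0 keeps its denominator away from zero at each point.\<close>
  have cont: "continuous_on I (\<lambda>t. \<kappa>1 \<alpha> t / \<kappa>0 \<alpha> t)"
    using conformable_kernels_continuous[OF assms(2), of \<alpha>] assms(3) nz
    by (auto intro!: continuous_on_divide)
  have "?W t = p b * ?W b * (conf_exp0 (\<kappa>0 \<alpha>) (\<kappa>1 \<alpha>) t b)\<^sup>2 / p t" if t: "t \<in> I" for t
  proof -
    \<comment> \<open>Here \<open>m = - 2\<close> and the unknown is \<open>p * ?W\<close>, whose
      value at \<open>b\<close> is the constant \<open>c\<close>.\<close>
    have "p t * ?W t = p b * ?W b * exp (- 2 * (LBINT \<tau>=b..t. \<kappa>1 \<alpha> \<tau> / \<kappa>0 \<alpha> \<tau>))"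
      by (rule linear_ode_solution[OF I assms(9) t cont])
        (rule wronskian_has_vector_derivative[OF assms(7,8) _ nz])
    also have "exp (- 2 * (LBINT \<tau>=b..t. \<kappa>1 \<alpha> \<tau> / \<kappa>0 \<alpha> \<tau>))
        = (conf_exp0 (\<kappa>0 \<alpha>) (\<kappa>1 \<alpha>) t b)\<^sup>2"
      by (simp add: conf_exp0_def flip: exp_double)
    finally show ?thesis
      using assms(6) t by (simp add: field_simps less_imp_neq[symmetric])
  qed
  then show ?thesis
    by (simp add: Let_def)
qed

end
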